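(* Suppose that the topological holonomy group $G_\nabla$ of an $h$-connection $\nabla$ of $E$ is contained in $SU(2)$ and has a noncommutative pair $(\hat B_1,\hat B_2)$ (elements $\hat B_1,\hat B_2\in G_\nabla$ with $\hat B_1\hat B_2\neq\hat B_2\hat B_1$) with $\mathrm{ord}(\hat B_1)=\infty$ and $\mathrm{ord}(\hat B_2)\neq2,4$. Then $G_\nabla$ is dense in $SU(2)$.
   Context: Let $T^2=S^1\times S^1$ with $S^1=\mathbb{R}/2\pi\mathbb{Z}$ and let $\mathrm{pr}:\mathbb{R}^2\to T^2$ be the projection. $E$ is a complex vector bundle over $T^2$ of (complex) rank 2 with a Hermitian metric $h$; an $h$-connection is a connection $\nabla$ of $E$ with $\nabla h=0$. Let $\tilde v_1,\tilde v_2$ be an orthonormal basis of $\mathrm{pr}^*E_{(0,0)}$, and let $\tilde\xi_{i,x}$ (resp. $\tilde\xi_{i,y}$) be the $\nabla$-parallel sections of $\mathrm{pr}^*E$ along the $x$-axis (resp. $y$-axis) with value $\tilde v_i$ at $(0,0)$. Identifying the fibers of the pull-back at $(x+2\pi m,y+2\pi n)$ and $(x,y)$ for $m,n\in\mathbb{Z}$, there are $B_1,B_2\in U(2)$ with $(\tilde\xi_{1,x}(a+2\pi,0)\ \tilde\xi_{2,x}(a+2\pi,0))=(\tilde\xi_{1,x}(a,0)\ \tilde\xi_{2,x}(a,0))B_1$ and $(\tilde\xi_{1,y}(0,b+2\pi)\ \tilde\xi_{2,y}(0,b+2\pi))=(\tilde\xi_{1,y}(0,b)\ \tilde\xi_{2,y}(0,b))B_2$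 for all $a,b\in\mathbb{R}$. The topological holonomy group $G_\nabla$ of $\nabla$ at $\mathrm{pr}(0,0)$ is the subgroup of $U(2)$ generated by $B_1,B_2$ (determined up to conjugation). $\mathrm{ord}$ denotes the order of a group element, in $\mathbb{N}\cup\{\infty\}$. *)

theory Defs
  imports
    "HOL-Analysis.Analysis"
    "HOL-Algebra.Multiplicative_Group"
    "HOL-Algebra.Generated_Groups"
    "HOL-Library.Extended_Nat"
begin

section \<open>The torus\<close>

quotient_type circle = real / "\<lambda>x y. \<exists>k::int. x - y = 2 * pi * of_int k"
proof (rule equivpI)
  show "reflp (\<lambda>x y. \<exists>k::int. x - y = 2 * pi * of_int k)"
    by (rule reflpI, rule exI[of _ 0]) simp
  show "symp (\<lambda>x y. \<exists>k::int. x - y = 2 * pi * of_int k)"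
  proof (rule sympI)
    fix x y :: real assume "\<exists>k::int. x - y = 2 * pi * of_int k"
    then obtain k :: int where "x - y = 2 * pi * of_int k" ..
    then have "y - x = 2 * pi * of_int (- k)" by simp
    then show "\<exists>k::int. y - x = 2 * pi * of_int k" ..
  qed
  show "transp (\<lambda>x y. \<exists>k::int. x - y = 2 * pi * of_int k)"
  proof (rule transpI)
    fix x y z :: real
    assume "\<exists>k::int. x - y = 2 * pi * of_int k" "\<exists>k::int. y - z = 2 * pi * of_int k"
    then obtain k l :: int where "x - y = 2 * pi * of_int k" "y - z = 2 * pi * of_int l" by blast
    then have "x - z = 2 * pi * of_int (k + l)" by (simp add: algebra_simps)
    then show "\<exists>k::int. x - z = 2 * pi * of_int k" ..
  qed
qed

instantiation circle :: topological_space
begin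

definition open_circle :: "circle set \<Rightarrow> bool" where
  "open_circle U \<longleftrightarrow> open (abs_circle -` U)"

instance
  by standard (auto simp: open_circle_def vimage_Union)

end

type_synonym torus = "circle \<times> circle"

definition pr :: "real \<times> real \<Rightarrow> torus" where
  "pr q = (abs_circle (fst q), abs_circle (snd q))"

section \<open>Smooth functions\<close>

text \<open>\<open>C_k_on k S f\<close> is meant for open \<open>S\<close> in a finite-dimensional space: all iterated
  directional derivatives of order at most \<open>k\<close> exist and are continuous.\<close>

primrec C_k_on ::
  "nat \<Rightarrow> 'a::real_normed_vector set \<Rightarrow> ('a \<Rightarrow> 'b::real_normed_vector) \<Rightarrow> bool" where
  "C_k_on 0 S f \<longleftrightarrow> continuous_on S f"
| "C_k_on (Suc k) S f \<longleftrightarrow>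
     (\<forall>x\<in>S. f differentiable (at x)) \<and> (\<forall>v. C_k_on k S (\<lambda>x. frechet_derivative f (at x) v))"

definition smooth_on ::
  "'a::real_normed_vector set \<Rightarrow> ('a \<Rightarrow> 'b::real_normed_vector) \<Rightarrow> bool" where
  "smooth_on S f \<longleftrightarrow> (\<forall>k. C_k_on k S f)"

text \<open>Since \<open>pr\<close> is a local diffeomorphism, smoothness on an open subset of the torus is
  smoothness of the lift to the plane.\<close>

definition torus_smooth_on :: "torus set \<Rightarrow> (torus \<Rightarrow> 'b::real_normed_vector) \<Rightarrow> bool" where
  "torus_smooth_on U f \<longleftrightarrow> smooth_on (pr -` U) (f \<circ> pr)"

text \<open>The coordinate fields trivialise the tangent bundle of the torus, so a vector field
  \<open>a \<partial>\<^sub>x + b \<partial>\<^sub>y\<close> is represented by the function \<open>(a, b)\<close>.\<close>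

type_synonym vfield = "torus \<Rightarrow> real \<times> real"

section \<open>Vector bundles, Hermitian metrics and connections\<close>

text \<open>The type \<open>'e\<close> is the total space. Addition is only meaningful on two vectors of the same
  fibre. A trivialisation over \<open>U\<close> is given by its second component \<open>\<phi>\<close>, which is only
  meaningful on the part of the total space over \<open>U\<close>.\<close>

record 'e vbundle =
  proj :: "'e \<Rightarrow> torus"
  vadd :: "'e \<Rightarrow> 'e \<Rightarrow> 'e"
  vscale :: "complex \<Rightarrow> 'e \<Rightarrow> 'e"
  trivs :: "(torus set \<times> ('e \<Rightarrow> complex ^ 2)) set"

text \<open>Smooth complex vector bundle of rank 2. Each trivialisation is a linear bijection from every
  fibre over its domain onto \<open>\<complex>\<^sup>2\<close>, and this forces the vector space axioms on the fibres.\<close>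

definition complex_vector_bundle_rank2 :: "'e vbundle \<Rightarrow> bool" where
  "complex_vector_bundle_rank2 E \<longleftrightarrow>
     (\<forall>u v. proj E u = proj E v \<longrightarrow> proj E (vadd E u v) = proj E u) \<and>
     (\<forall>c u. proj E (vscale E c u) = proj E u) \<and>
     \<Union> (fst ` trivs E) = UNIV \<and>
     (\<forall>(U, \<phi>) \<in> trivs E. open U \<and>
        (\<forall>p\<in>U. bij_betw \<phi> (proj E -` {p}) UNIV) \<and>
        (\<forall>u v. proj E u \<in> U \<and> proj E u = proj E v \<longrightarrow> \<phi> (vadd E u v) = \<phi> u + \<phi> v) \<and>
        (\<forall>c u. proj E u \<in> U \<longrightarrow> \<phi> (vscale E c u) = c *s \<phi> u)) \<and>
     (\<forall>(U, \<phi>) \<in> trivs E. \<forall>(V, \<psi>) \<in> trivs E.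
        \<exists>g :: torus \<Rightarrow> complex ^ 2 ^ 2. torus_smooth_on (U \<inter> V) g \<and>
          (\<forall>u. proj E u \<in> U \<inter> V \<longrightarrow> \<psi> u = g (proj E u) *v \<phi> u))"

definition smooth_section :: "'e vbundle \<Rightarrow> (torus \<Rightarrow> 'e) \<Rightarrow> bool" where
  "smooth_section E s \<longleftrightarrow> (\<forall>p. proj E (s p) = p) \<and>
     (\<forall>(U, \<phi>) \<in> trivs E. torus_smooth_on U (\<lambda>p. \<phi> (s p)))"

text \<open>The term \<open>vscale E 0 u\<close> is the zero vector of the fibre containing \<open>u\<close>.\<close>

definition hermitian_metric :: "'e vbundle \<Rightarrow> ('e \<Rightarrow> 'e \<Rightarrow> complex) \<Rightarrow> bool" where
  "hermitian_metric E h \<longleftrightarrow>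
     (\<forall>u v w. proj E u = proj E v \<and> proj E v = proj E w \<longrightarrow> h (vadd E u v) w = h u w + h v w) \<and>
     (\<forall>c u v. proj E u = proj E v \<longrightarrow> h (vscale E c u) v = c * h u v) \<and>
     (\<forall>u v. proj E u = proj E v \<longrightarrow> h v u = cnj (h u v)) \<and>
     (\<forall>u. u \<noteq> vscale E 0 u \<longrightarrow> 0 < Re (h u u)) \<and>
     (\<forall>s t. smooth_section E s \<and> smooth_section E t \<longrightarrow> torus_smooth_on UNIV (\<lambda>p. h (s p) (t p)))"

text \<open>A connection as a covariant derivative \<open>\<nabla>\<^sub>X s = D X s\<close>. In the Leibniz rule the
  derivative of \<open>f\<close> in direction \<open>X\<close> at the point \<open>pr q\<close> is that of the lift \<open>f \<circ> pr\<close> at \<open>q\<close>.\<close>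

definition connection :: "'e vbundle \<Rightarrow> (vfield \<Rightarrow> (torus \<Rightarrow> 'e) \<Rightarrow> (torus \<Rightarrow> 'e)) \<Rightarrow> bool" where
  "connection E D \<longleftrightarrow>
     (\<forall>X s. torus_smooth_on UNIV X \<and> smooth_section E s \<longrightarrow> smooth_section E (D X s)) \<and>
     (\<forall>X Y s. torus_smooth_on UNIV X \<and> torus_smooth_on UNIV Y \<and> smooth_section E s \<longrightarrow>
        D (\<lambda>p. X p + Y p) s = (\<lambda>p. vadd E (D X s p) (D Y s p))) \<and>
     (\<forall>(f :: torus \<Rightarrow> real) X s.
        torus_smooth_on UNIV f \<and> torus_smooth_on UNIV X \<and> smooth_section E s \<longrightarrow>
        D (\<lambda>p. f p *\<^sub>R X p) s = (\<lambda>p. vscale E (of_real (f p)) (D X s p))) \<and>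
     (\<forall>X s t. torus_smooth_on UNIV X \<and> smooth_section E s \<and> smooth_section E t \<longrightarrow>
        D X (\<lambda>p. vadd E (s p) (t p)) = (\<lambda>p. vadd E (D X s p) (D X t p))) \<and>
     (\<forall>(f :: torus \<Rightarrow> complex) X s.
        torus_smooth_on UNIV f \<and> torus_smooth_on UNIV X \<and> smooth_section E s \<longrightarrow>
        (\<forall>q. D X (\<lambda>p. vscale E (f p) (s p)) (pr q) =
           vadd E (vscale E (frechet_derivative (f \<circ> pr) (at q) (X (pr q))) (s (pr q)))
                 (vscale E (f (pr q)) (D X s (pr q)))))"

text \<open>The last condition is \<open>\<nabla> h = 0\<close>.\<close>

definition h_connection ::
  "'e vbundle \<Rightarrow> ('e \<Rightarrow> 'e \<Rightarrow> complex) \<Rightarrow> (vfield \<Rightarrow> (torus \<Rightarrow> 'e) \<Rightarrow> (torus \<Rightarrow> 'e)) \<Rightarrow> bool" where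
  "h_connection E h D \<longleftrightarrow> connection E D \<and>
     (\<forall>X s t. torus_smooth_on UNIV X \<and> smooth_section E s \<and> smooth_section E t \<longrightarrow>
        (\<forall>q. frechet_derivative ((\<lambda>p. h (s p) (t p)) \<circ> pr) (at q) (X (pr q)) =
           h (D X s (pr q)) (t (pr q)) + h (s (pr q)) (D X t (pr q))))"

section \<open>Parallel sections of the pull-back bundle\<close>

text \<open>The fibre of \<open>pr\<^sup>*E\<close> at \<open>q\<close> is the fibre of \<open>E\<close> at \<open>pr q\<close>, so a section of \<open>pr\<^sup>*E\<close> along a curve
  \<open>c\<close> in the plane is a map \<open>\<xi>\<close> into the total space of \<open>E\<close> that covers \<open>pr \<circ> c\<close>. In particular
  the fibres at \<open>q\<close> and \<open>q + (2\<pi>m, 2\<pi>n)\<close> are the same set. The pull-back connection is determined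
  by the Leibniz rule and \<open>\<nabla>\<^bsub>c'\<^esub> (s \<circ> pr) = (\<nabla>\<^bsub>c'\<^esub> s) \<circ> pr\<close>: near the parameter \<open>t\<close> write
  \<open>\<xi> = f\<^sub>1 s\<^sub>1 + f\<^sub>2 s\<^sub>2\<close> with sections \<open>s\<^sub>1, s\<^sub>2\<close> of \<open>E\<close>; then the derivative is
  \<open>(f\<^sub>1' s\<^sub>1 + f\<^sub>1 \<nabla>\<^bsub>c'\<^esub> s\<^sub>1) + (f\<^sub>2' s\<^sub>2 + f\<^sub>2 \<nabla>\<^bsub>c'\<^esub> s\<^sub>2)\<close>. The value \<open>(\<nabla>\<^sub>X s)(p)\<close> depends on \<open>X\<close> only through
  \<open>X p\<close>, so the constant field with value \<open>c' t\<close> is used.\<close>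

definition has_covariant_derivative_along ::
  "'e vbundle \<Rightarrow> (vfield \<Rightarrow> (torus \<Rightarrow> 'e) \<Rightarrow> (torus \<Rightarrow> 'e)) \<Rightarrow>
   (real \<Rightarrow> real \<times> real) \<Rightarrow> (real \<Rightarrow> 'e) \<Rightarrow> real \<Rightarrow> 'e \<Rightarrow> bool" where
  "has_covariant_derivative_along E D c \<xi> t \<eta> \<longleftrightarrow>
     (\<exists>f1 f2 s1 s2. smooth_on UNIV f1 \<and> smooth_on UNIV f2 \<and>
        smooth_section E s1 \<and> smooth_section E s2 \<and>
        (\<forall>\<^sub>F r in nhds t.
           \<xi> r = vadd E (vscale E (f1 r) (s1 (pr (c r)))) (vscale E (f2 r) (s2 (pr (c r))))) \<and>
        (let p = pr (c t); X = (\<lambda>_. vector_derivative c (at t)) in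
         \<eta> = vadd E
           (vadd E (vscale E (vector_derivative f1 (at t)) (s1 p)) (vscale E (f1 t) (D X s1 p)))
           (vadd E (vscale E (vector_derivative f2 (at t)) (s2 p)) (vscale E (f2 t) (D X s2 p)))))"

definition parallel_along ::
  "'e vbundle \<Rightarrow> (vfield \<Rightarrow> (torus \<Rightarrow> 'e) \<Rightarrow> (torus \<Rightarrow> 'e)) \<Rightarrow>
   (real \<Rightarrow> real \<times> real) \<Rightarrow> (real \<Rightarrow> 'e) \<Rightarrow> bool" where
  "parallel_along E D c \<xi> \<longleftrightarrow>
     (\<forall>t. proj E (\<xi> t) = pr (c t)) \<and>
     (\<forall>t. has_covariant_derivative_along E D c \<xi> t (vscale E 0 (\<xi> t)))"

section \<open>Unitary matrices\<close>

definition conj_transpose :: "complex ^ 2 ^ 2 \<Rightarrow> complex ^ 2 ^ 2" where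
  "conj_transpose A = map_matrix cnj (transpose A)"

definition U2 :: "(complex ^ 2 ^ 2) monoid" where
  "U2 = \<lparr>carrier = {A. conj_transpose A ** A = mat 1 \<and> A ** conj_transpose A = mat 1},
         monoid.mult = (**), one = mat 1\<rparr>"

definition SU2 :: "(complex ^ 2 ^ 2) set" where
  "SU2 = {A \<in> carrier U2. det A = 1}"

lemma conj_transpose_mult: "conj_transpose (A ** B) = conj_transpose B ** conj_transpose A"
  by (simp add: conj_transpose_def vec_eq_iff transpose_def matrix_matrix_mult_def mult.commute)

lemma conj_transpose_one [simp]: "conj_transpose (mat 1) = mat 1"
  by (auto simp: conj_transpose_def vec_eq_iff transpose_def mat_def)

lemma conj_transpose_conj_transpose [simp]: "conj_transpose (conj_transpose A) = A"
  by (simp add: conj_transpose_def vec_eq_iff transpose_def)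

lemma group_U2: "group U2"
proof (rule groupI)
  fix A B assume "A \<in> carrier U2" "B \<in> carrier U2"
  then have A: "conj_transpose A ** A = mat 1" "A ** conj_transpose A = mat 1"
    and B: "conj_transpose B ** B = mat 1" "B ** conj_transpose B = mat 1"
    by (auto simp: U2_def)
  have "(conj_transpose B ** conj_transpose A) ** (A ** B)
      = conj_transpose B ** (conj_transpose A ** A) ** B"
    by (simp add: matrix_mul_assoc)
  moreover have "(A ** B) ** (conj_transpose B ** conj_transpose A)
      = A ** (B ** conj_transpose B) ** conj_transpose A"
    by (simp add: matrix_mul_assoc)
  ultimately show "A \<otimes>\<^bsub>U2\<^esub> B \<in> carrier U2"
    using A B by (simp add: U2_def conj_transpose_mult)
next
  fix A assume "A \<in> carrier U2"
  then show "\<exists>B\<in>carrier U2. B \<otimes>\<^bsub>U2\<^esub> A = \<one>\<^bsub>U2\<^esub>"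
    by (intro bexI[of _ "conj_transpose A"]) (auto simp: U2_def)
qed (auto simp: U2_def matrix_mul_assoc)

text \<open>The constant \<open>group.ord\<close> returns 0 on elements of infinite order.\<close>

definition elt_order :: "('a, 'b) monoid_scheme \<Rightarrow> 'a \<Rightarrow> enat" where
  "elt_order G a = (if group.ord G a = 0 then \<infinity> else enat (group.ord G a))"

section \<open>The topological holonomy group\<close>

text \<open>The matrix relation \<open>(\<zeta>\<^sub>1 \<zeta>\<^sub>2) = (\<xi>\<^sub>1 \<xi>\<^sub>2) B\<close> for vectors in one fibre.\<close>

definition frame_change ::
  "'e vbundle \<Rightarrow> (2 \<Rightarrow> 'e) \<Rightarrow> (2 \<Rightarrow> 'e) \<Rightarrow> complex ^ 2 ^ 2 \<Rightarrow> bool" where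
  "frame_change E \<zeta> \<xi> B \<longleftrightarrow>
     (\<forall>j. \<zeta> j = vadd E (vscale E (B $ 1 $ j) (\<xi> 1)) (vscale E (B $ 2 $ j) (\<xi> 2)))"

text \<open>The matrices depend on the orthonormal basis \<open>v\<close> and the group is determined only up to
  conjugation. Hence this is a predicate, satisfied by the group of each such basis.\<close>

definition topological_holonomy_group ::
  "'e vbundle \<Rightarrow> ('e \<Rightarrow> 'e \<Rightarrow> complex) \<Rightarrow> (vfield \<Rightarrow> (torus \<Rightarrow> 'e) \<Rightarrow> (torus \<Rightarrow> 'e)) \<Rightarrow>
   (complex ^ 2 ^ 2) set \<Rightarrow> bool" where
  "topological_holonomy_group E h D G \<longleftrightarrow>
     (\<exists>(v :: 2 \<Rightarrow> 'e) (\<xi>x :: 2 \<Rightarrow> real \<Rightarrow> 'e) (\<xi>y :: 2 \<Rightarrow> real \<Rightarrow> 'e) B1 B2.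
        (\<forall>i. proj E (v i) = pr (0, 0)) \<and>
        (\<forall>i j. h (v i) (v j) = (if i = j then 1 else 0)) \<and>
        (\<forall>i. parallel_along E D (\<lambda>t. (t, 0)) (\<xi>x i) \<and> \<xi>x i 0 = v i) \<and>
        (\<forall>i. parallel_along E D (\<lambda>t. (0, t)) (\<xi>y i) \<and> \<xi>y i 0 = v i) \<and>
        B1 \<in> carrier U2 \<and> B2 \<in> carrier U2 \<and>
        (\<forall>a. frame_change E (\<lambda>i. \<xi>x i (a + 2 * pi)) (\<lambda>i. \<xi>x i a) B1) \<and>
        (\<forall>b. frame_change E (\<lambda>i. \<xi>y i (b + 2 * pi)) (\<lambda>i. \<xi>y i b) B2) \<and>
        G = generate U2 {B1, B2})"

end

theory Submission
  imports Defs "HOL-Analysis.Kronecker_Approximation_Theorem"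
begin

text \<open>The holonomy group is a subgroup \<open>G\<close> of \<open>SU(2)\<close>, so its closure \<open>K\<close> is a closed set of
  matrices that is stable under products. Diagonalise the element
  of infinite order. Its eigenvalues are \<open>u\<close> and \<open>cnj u\<close> where \<open>u\<close> lies on the unit circle and is
  not a root of unity, so by Kronecker's theorem its powers are dense in the diagonal torus, which
  is therefore contained in \<open>K\<close> (\<open>torus_in_closed_submonoid\<close>).

  In this basis the other element has the first column \<open>(a, b)\<close>. It does not commute with the first
  element, so \<open>b \<noteq> 0\<close>; if \<open>a\<close> vanished, its square would be \<open>-1\<close> and its order would be 4.
  Multiplication by the torus on both sides makes the phases of \<open>a\<close> and \<open>b\<close> arbitrary, so that
  membership in \<open>K\<close> depends on \<open>\<bar>a\<bar>\<close> and \<open>\<bar>b\<bar>\<close> only (\<open>su2_change_phases\<close>). Products of three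
  matrices then yield all \<open>(c, d)\<close> on the unit sphere with \<open>\<bar>d\<bar> \<le> 2 \<bar>a\<bar> \<bar>b\<bar>\<close>
  (\<open>su2_small_second_entry\<close>); in particular \<open>K\<close> contains all real rotations by sufficiently small
  angles. These generate all rotations, and changing the phases gives all of \<open>SU(2)\<close>.\<close>

section \<open>Special unitary matrices as pairs of complex numbers\<close>

text \<open>On the unit sphere \<open>\<bar>a\<bar>\<^sup>2 + \<bar>b\<bar>\<^sup>2 = 1\<close> of \<open>\<complex>\<^sup>2\<close>, this is the usual identification of the
  unit quaternions with \<open>SU(2)\<close>; the pair \<open>(a, b)\<close> is the first column.\<close>

definition su2 :: "complex \<Rightarrow> complex \<Rightarrow> complex ^ 2 ^ 2" where
  "su2 a b = vector [vector [a, - cnj b], vector [b, cnj a]]"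

lemma su2_eq_iff: "su2 a b = su2 c d \<longleftrightarrow> a = c \<and> b = d"
  by (auto simp: su2_def vec_eq_iff forall_2)

lemma su2_mult: "su2 a b ** su2 c d = su2 (a * c - cnj b * d) (b * c + cnj a * d)"
  by (simp add: su2_def vec_eq_iff forall_2 matrix_matrix_mult_def sum_2 algebra_simps)

lemma mat_1_eq_su2: "mat 1 = su2 1 0"
  by (simp add: su2_def vec_eq_iff forall_2 mat_def)

lemma conj_transpose_su2: "conj_transpose (su2 a b) = su2 (cnj a) (- b)"
  by (simp add: su2_def vec_eq_iff forall_2 conj_transpose_def transpose_def)

lemma unit_sphere_iff:
  fixes a b :: complex
  shows "a * cnj a + b * cnj b = 1 \<longleftrightarrow> (cmod a)\<^sup>2 + (cmod b)\<^sup>2 = 1"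
proof -
  have "a * cnj a + b * cnj b = complex_of_real ((cmod a)\<^sup>2 + (cmod b)\<^sup>2)"
    by (simp only: of_real_add complex_norm_square)
  then show ?thesis
    by (simp only: of_real_eq_1_iff)
qed

lemma su2_in_SU2:
  assumes "a * cnj a + b * cnj b = 1"
  shows "su2 a b \<in> SU2"
proof -
  have "cnj a * a + cnj b * b = 1" "a * cnj a + cnj b * b = 1"
    using assms by (simp_all add: mult.commute)
  then show ?thesis
    using assms
    by (auto simp: SU2_def U2_def conj_transpose_su2 su2_mult mat_1_eq_su2 su2_eq_iff mult.commute)
      (simp add: su2_def det_2 mult.commute)
qed

lemma SU2_cases:
  assumes "A \<in> SU2"
  obtains a b where "A = su2 a b" "a * cnj a + b * cnj b = 1"
proof -
  define p q r s where "p = A $ 1 $ 1" and "q = A $ 1 $ 2" and "r = A $ 2 $ 1" and "s = A $ 2 $ 2"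
  note entries = p_def q_def r_def s_def
  have "conj_transpose A ** A = mat 1" and det: "p * s - q * r = 1"
    using assms by (auto simp: SU2_def U2_def det_2 entries)
  then have col: "cnj p * p + cnj r * r = 1" and orth: "cnj p * q + cnj r * s = 0"
    by (simp_all add: vec_eq_iff forall_2 matrix_matrix_mult_def sum_2 mat_def conj_transpose_def
        transpose_def entries)
  have "(cnj p * p + cnj r * r) * s = cnj p * (p * s - q * r) + r * (cnj p * q + cnj r * s)"
    by (simp add: algebra_simps)
  then have "s = cnj p"
    by (simp add: col orth det)
  moreover have "(cnj p * p + cnj r * r) * q
      = p * (cnj p * q + cnj r * s) - cnj r * (p * s - q * r)"
    by (simp add: algebra_simps)
  then have "q = - cnj r"
    by (simp add: col orth det)
  ultimately have "A = su2 p r"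
    by (simp add: su2_def vec_eq_iff forall_2 entries)
  with col show thesis
    by (intro that[of p r]) (simp_all add: mult.commute)
qed

lemma unit_torus_in_SU2: "cmod u = 1 \<Longrightarrow> su2 u 0 \<in> SU2"
  by (rule su2_in_SU2) (simp flip: complex_norm_square)

lemma SU2_mult_closed: "A \<in> SU2 \<Longrightarrow> B \<in> SU2 \<Longrightarrow> A ** B \<in> SU2"
  using group.subgroup_self[OF group_U2, THEN subgroup.m_closed, of A B]
  by (auto simp: SU2_def det_mul U2_def)

lemma conj_transpose_in_SU2: "A \<in> SU2 \<Longrightarrow> conj_transpose A \<in> SU2"
  by (elim SU2_cases) (auto simp: conj_transpose_su2 mult.commute intro!: su2_in_SU2)

lemma SU2_conj_transpose:
  assumes "A \<in> SU2"
  shows "A ** conj_transpose A = mat 1" "conj_transpose A ** A = mat 1"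
  using assms by (auto simp: SU2_def U2_def)

text \<open>The characteristic polynomial of \<open>su2 a b\<close> is \<open>z\<^sup>2 - 2 (Re a) z + 1\<close>; its roots lie on the
  unit circle because \<open>\<bar>Re a\<bar> \<le> 1\<close>. For \<open>b \<noteq> 0\<close> and a root \<open>l\<close>, the vector \<open>(cnj b, a - l)\<close> is an
  eigenvector, and normalised it is the first column of a diagonalising matrix.\<close>

lemma SU2_diagonalise:
  assumes "A \<in> SU2"
  obtains P u where "P \<in> SU2" "cmod u = 1" "A ** P = P ** su2 u 0"
proof -
  obtain a b where A: "A = su2 a b" and ab: "a * cnj a + b * cnj b = 1"
    using assms by (rule SU2_cases)
  show thesis
  proof (cases "b = 0")
    case True
    then have "cmod a = 1"
      using ab unfolding unit_sphere_iff by (simp add: power2_eq_1_iff)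
        (use norm_ge_zero[of a] in linarith)
    then show thesis
      using True A unit_torus_in_SU2[of 1]
      by (intro that[of "su2 1 0" a]) (auto simp: su2_mult)
  next
    case False
    define x where "x = Re a"
    have "(cmod a)\<^sup>2 + (cmod b)\<^sup>2 = 1"
      using ab by (simp only: unit_sphere_iff)
    then have "x\<^sup>2 \<le> 1"
      unfolding x_def cmod_power2 by (smt (verit) zero_le_power2)
    define l where "l = Complex x (sqrt (1 - x\<^sup>2))"
    have l1: "cmod l = 1"
      using \<open>x\<^sup>2 \<le> 1\<close> by (simp add: l_def cmod_def)
    have "l + cnj l = a + cnj a"
      by (simp add: l_def x_def complex_eq_iff)
    moreover have "l * cnj l = 1"
      using l1 by (simp flip: complex_norm_square)
    moreover have "l * l = (l + cnj l) * l - l * cnj l"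
      by (simp add: algebra_simps)
    ultimately have charpoly: "l * l = (a + cnj a) * l - 1"
      by simp
    define n where "n = sqrt ((cmod b)\<^sup>2 + (cmod (a - l))\<^sup>2)"
    have "n > 0"
      using False by (auto simp: n_def intro!: add_pos_nonneg)
    define P where "P = su2 (cnj b / n) ((a - l) / n)"
    have "complex_of_real n * n = of_real ((cmod b)\<^sup>2 + (cmod (a - l))\<^sup>2)"
      unfolding of_real_mult[symmetric] by (simp add: n_def)
    also have "\<dots> = b * cnj b + (a - l) * cnj (a - l)"
      by (simp only: of_real_add complex_norm_square)
    finally have n2: "b * cnj b + (a - l) * cnj (a - l) = of_real n * of_real n" ..
    have "P \<in> SU2"
      unfolding P_def using \<open>n > 0\<close> n2
      by (intro su2_in_SU2) (simp add: field_simps del: complex_cnj_diff)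
    moreover have "A ** P = P ** su2 l 0"
    proof -
      have "b * cnj b + cnj a * (a - l) = (a - l) * l"
      proof -
        have "(a - l) * l = a * l - l * l"
          by (simp add: algebra_simps)
        also have "\<dots> = (a * cnj a + b * cnj b) - cnj a * l"
          unfolding charpoly ab by (simp add: algebra_simps)
        finally show ?thesis
          by (simp add: algebra_simps)
      qed
      then have "b * (cnj b / n) + cnj a * ((a - l) / n) = (a - l) / n * l"
        by (metis add_divide_distrib times_divide_eq_left times_divide_eq_right)
      moreover have "a * (cnj b / n) - cnj b * ((a - l) / n) = cnj b / n * l"
        using \<open>n > 0\<close> by (simp add: field_simps)
      ultimately show ?thesis
        by (simp add: A P_def su2_mult)
    qed
    ultimately show thesis
      using l1 that by blast
  qed
qed

section \<open>Density of the powers of a point of the unit circle\<close>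

text \<open>With \<open>u = exp (2 \<pi> \<i> \<theta>)\<close> the number \<open>\<theta>\<close> is irrational, so the fractional parts of its
  multiples are dense in the unit interval, and \<open>u ^ n\<close> is the image of the fractional part of
  \<open>n \<theta>\<close> under the continuous map \<open>t \<mapsto> exp (2 \<pi> \<i> t)\<close>, which maps onto the unit circle.\<close>

lemma unit_circle_subset_closure_powers:
  fixes u v :: complex
  assumes u: "cmod u = 1" and nonroot: "\<And>n::nat. n > 0 \<Longrightarrow> u ^ n \<noteq> 1" and v: "cmod v = 1"
  shows "v \<in> closure (range (\<lambda>n. u ^ n))"
proof -
  define \<theta> where "\<theta> = Arg2pi u / (2 * pi)"
  have u_cis: "u = cis (2 * pi * \<theta>)"
    using u by (simp add: \<theta>_def complex_norm_eq_1_exp cis_conv_exp)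
  have power: "u ^ n = cis (2 * pi * frac (real n * \<theta>))" for n
  proof -
    have "real n * (2 * pi * \<theta>)
        = 2 * pi * frac (real n * \<theta>) + 2 * pi * of_int \<lfloor>real n * \<theta>\<rfloor>"
      by (simp add: frac_def algebra_simps)
    then have "u ^ n = cis (2 * pi * frac (real n * \<theta>) + 2 * pi * of_int \<lfloor>real n * \<theta>\<rfloor>)"
      by (simp only: u_cis Complex.DeMoivre)
    also have "\<dots> = cis (2 * pi * frac (real n * \<theta>))"
      by (simp add: cis_mult[symmetric] cis_multiple_2pi)
    finally show ?thesis .
  qed
  have "\<theta> \<notin> \<rat>"
  proof
    assume "\<theta> \<in> \<rat>"
    then obtain k :: int and m :: nat where "m > 0" "\<theta> = of_int k / of_nat m"
      by (rule Rats_cases') (metis of_int_of_nat_eq pos_int_cases)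
    then have "u ^ m = 1"
      by (simp add: power)
    with nonroot \<open>m > 0\<close> show False by blast
  qed
  then have dense: "closure (range (\<lambda>n. frac (real n * \<theta>))) = {0..1}"
    by (rule Kronecker_approx_1)
  have "(\<lambda>t. cis (2 * pi * t)) ` closure (range (\<lambda>n. frac (real n * \<theta>)))
      \<subseteq> closure (range (\<lambda>n. u ^ n))"
    by (rule image_closure_subset)
      (auto simp: power intro!: continuous_intros closure_subset[THEN subsetD])
  moreover have "v = cis (2 * pi * (Arg2pi v / (2 * pi)))"
    using v by (simp add: complex_norm_eq_1_exp cis_conv_exp)
  moreover have "Arg2pi v / (2 * pi) \<in> {0..1}"
    using Arg2pi[of v] by simp
  ultimately show ?thesis
    unfolding dense by blast
qed

lemma torus_in_closed_submonoid:
  assumes "closed K" and "\<And>A B. A \<in> K \<Longrightarrow> B \<in> K \<Longrightarrow> A ** B \<in> K" and "mat 1 \<in> K"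
    and u: "su2 u 0 \<in> K" "cmod u = 1" "\<And>n::nat. n > 0 \<Longrightarrow> u ^ n \<noteq> 1"
    and "cmod v = 1"
  shows "su2 v 0 \<in> K"
proof -
  have "su2 (u ^ n) 0 \<in> K" for n
  proof (induction n)
    case (Suc n)
    then have "su2 u 0 ** su2 (u ^ n) 0 \<in> K"
      using assms by blast
    then show ?case by (simp add: su2_mult)
  qed (use \<open>mat 1 \<in> K\<close> in \<open>simp add: mat_1_eq_su2\<close>)
  moreover have "continuous_on UNIV (\<lambda>z. su2 z 0)"
  proof -
    have "su2 z 0 = (\<chi> i j. if i = 1 then if j = 1 then z else 0 else if j = 1 then 0 else cnj z)"
      for z by (simp add: su2_def vec_eq_iff forall_2)
    moreover have "continuous_on UNIV (\<lambda>z::complex. (if i = (1::2) then if j = (1::2) then z else 0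
        else if j = 1 then 0 else cnj z))" for i j
      by (cases "i = 1"; cases "j = 1") (simp_all add: continuous_intros)
    ultimately show ?thesis
      by (simp only:) (intro continuous_on_vec_lambda)
  qed
  ultimately have "(\<lambda>z. su2 z 0) ` closure (range (\<lambda>n. u ^ n)) \<subseteq> K"
    by (intro image_closure_subset \<open>closed K\<close>) (auto intro: continuous_on_subset)
  then show ?thesis
    using unit_circle_subset_closure_powers[OF u(2,3) \<open>cmod v = 1\<close>] by blast
qed

section \<open>Submonoids that contain the diagonal torus\<close>

lemma ex_unit_factor:
  fixes z w :: complex
  assumes "cmod w = cmod z"
  obtains p where "cmod p = 1" "w = p * z"
  using assms by (intro that[of "if z = 0 then 1 else w / z"]) (auto simp: norm_divide)

text \<open>One has \<open>diag(\<alpha>) (a, b) diag(\<beta>) = (\<alpha> \<beta> a, cnj \<alpha> \<beta> b)\<close>, and the map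
  \<open>(\<alpha>, \<beta>) \<mapsto> (\<alpha> \<beta>, cnj \<alpha> \<beta>)\<close> from the square of the unit circle to itself is onto.\<close>

lemma su2_change_phases:
  assumes mult: "\<And>A B. A \<in> K \<Longrightarrow> B \<in> K \<Longrightarrow> A ** B \<in> K"
    and torus: "\<And>v. cmod v = 1 \<Longrightarrow> su2 v 0 \<in> K"
    and "su2 a b \<in> K" and "cmod c = cmod a" "cmod d = cmod b"
  shows "su2 c d \<in> K"
proof -
  obtain p where p: "cmod p = 1" "c = p * a"
    using \<open>cmod c = cmod a\<close> by (rule ex_unit_factor)
  obtain q where q: "cmod q = 1" "d = q * b"
    using \<open>cmod d = cmod b\<close> by (rule ex_unit_factor)
  \<comment> \<open>The equations \<open>\<alpha> \<beta> = p\<close> and \<open>cnj \<alpha> \<beta> = q\<close> have the product \<open>\<beta>\<^sup>2 = p q\<close>.\<close>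
  define \<beta> where "\<beta> = csqrt (p * q)"
  define \<alpha> where "\<alpha> = p * cnj \<beta>"
  have \<beta>2: "\<beta> * \<beta> = p * q"
    by (metis \<beta>_def power2_csqrt power2_eq_square)
  have "cmod \<beta> = 1"
    using p q by (simp add: \<beta>_def norm_mult)
  then have unit: "\<beta> * cnj \<beta> = 1" "p * cnj p = 1"
    using p by (simp_all flip: complex_norm_square)
  have "su2 \<alpha> 0 \<in> K" "su2 \<beta> 0 \<in> K"
    using \<open>cmod \<beta> = 1\<close> p by (auto intro!: torus simp: \<alpha>_def norm_mult)
  then have "su2 \<alpha> 0 ** su2 a b ** su2 \<beta> 0 \<in> K"
    using \<open>su2 a b \<in> K\<close> by (intro mult)
  moreover have "\<alpha> * a * \<beta> = c"
    using unit by (simp add: \<alpha>_def p mult.assoc) (metis mult.commute mult.left_commute mult_1)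
  moreover have "cnj \<alpha> * b * \<beta> = d"
  proof -
    have "cnj \<alpha> * \<beta> = q"
      using \<beta>2 unit(2) by (simp add: \<alpha>_def mult.assoc) (simp add: ac_simps flip: mult.assoc)
    then show ?thesis by (simp add: q ac_simps)
  qed
  ultimately show ?thesis by (simp add: su2_mult)
qed

text \<open>For real \<open>a\<close> and \<open>b\<close> the second entry of \<open>(a, b) diag(\<alpha>) (a, b)\<close> is \<open>2 a b Re \<alpha>\<close>, and
  \<open>Re \<alpha>\<close> takes every value between \<open>-1\<close> and \<open>1\<close>.\<close>

lemma su2_small_second_entry:
  assumes mult: "\<And>A B. A \<in> K \<Longrightarrow> B \<in> K \<Longrightarrow> A ** B \<in> K"
    and torus: "\<And>v. cmod v = 1 \<Longrightarrow> su2 v 0 \<in> K"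
    and "su2 a b \<in> K" and ab: "(cmod a)\<^sup>2 + (cmod b)\<^sup>2 = 1"
    and cd: "(cmod c)\<^sup>2 + (cmod d)\<^sup>2 = 1" and le: "cmod d \<le> 2 * cmod a * cmod b"
  shows "su2 c d \<in> K"
proof -
  define x y where "x = cmod a" and "y = cmod b"
  have xy: "x\<^sup>2 + y\<^sup>2 = 1" "0 \<le> x" "0 \<le> y"
    using ab by (simp_all add: x_def y_def)
  have real_rep: "su2 x y \<in> K"
    by (rule su2_change_phases[OF mult torus \<open>su2 a b \<in> K\<close>]) (simp_all add: x_def y_def)
  define s where "s = (if x * y = 0 then 0 else cmod d / (2 * x * y))"
  have s: "2 * x * y * s = cmod d"
    using le by (auto simp: s_def x_def y_def)
  have "0 \<le> s" "s \<le> 1"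
    using le xy by (auto simp: s_def x_def y_def divide_le_eq zero_less_mult_iff)
  then have "s\<^sup>2 \<le> 1"
    by (simp add: power_le_one)
  define t where "t = sqrt (1 - s\<^sup>2)"
  have t2: "t\<^sup>2 = 1 - s\<^sup>2"
    using \<open>s\<^sup>2 \<le> 1\<close> by (simp add: t_def)
  define \<alpha> where "\<alpha> = Complex s t"
  have "cmod \<alpha> = 1"
    by (simp add: \<alpha>_def cmod_def t2)
  \<comment> \<open>The first entry of the product. Its modulus is that of \<open>c\<close>, since both columns are unit
    vectors whose second entries have the modulus of \<open>d\<close>.\<close>
  define e where "e = Complex ((x\<^sup>2 - y\<^sup>2) * s) t"
  have "su2 x y ** su2 \<alpha> 0 ** su2 x y = su2 e (cmod d)"
  proof -
    have "x * t * x + y * t * y = (x\<^sup>2 + y\<^sup>2) * t"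
      by (simp add: power2_eq_square algebra_simps)
    also have "\<dots> = t"
      by (simp add: xy)
    finally have "of_real x * \<alpha> * of_real x - cnj (of_real y * \<alpha>) * of_real y = e"
      unfolding complex_eq_iff by (simp add: e_def \<alpha>_def) (simp add: power2_eq_square algebra_simps)
    moreover have "of_real y * \<alpha> * of_real x + cnj (of_real x * \<alpha>) * of_real y = of_real (cmod d)"
      unfolding complex_eq_iff s[symmetric] by (simp add: \<alpha>_def)
    ultimately show ?thesis
      by (simp add: su2_mult)
  qed
  moreover have "su2 x y ** su2 \<alpha> 0 ** su2 x y \<in> K"
    using real_rep torus[OF \<open>cmod \<alpha> = 1\<close>] by (intro mult)
  ultimately have in_K: "su2 e (cmod d) \<in> K"
    by simp
  have "(cmod e)\<^sup>2 + (cmod d)\<^sup>2 = ((x\<^sup>2 - y\<^sup>2)\<^sup>2 + 4 * x\<^sup>2 * y\<^sup>2) * s\<^sup>2 + (1 - s\<^sup>2)"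
    unfolding cmod_power2[of e] s[symmetric]
    by (simp add: e_def t2 power_mult_distrib) (simp add: algebra_simps)
  also have "(x\<^sup>2 - y\<^sup>2)\<^sup>2 + 4 * x\<^sup>2 * y\<^sup>2 = (x\<^sup>2 + y\<^sup>2)\<^sup>2"
    by (simp add: power2_eq_square algebra_simps)
  finally have "(cmod e)\<^sup>2 + (cmod d)\<^sup>2 = 1"
    by (simp add: xy)
  with cd have "(cmod c)\<^sup>2 = (cmod e)\<^sup>2"
    by linarith
  then have "cmod c = cmod e"
    by simp
  then show ?thesis
    by (intro su2_change_phases[OF mult torus in_K]) simp_all
qed

text \<open>The rotation by the angle \<open>\<psi>\<close> is a power of the rotation by \<open>\<psi> / n\<close>, whose second entry
  \<open>sin (\<psi> / n)\<close> is below the positive bound \<open>2 \<bar>a\<bar> \<bar>b\<bar>\<close> once \<open>n\<close> is large.\<close>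

lemma SU2_subset_if_torus_and_generic_element:
  assumes mult: "\<And>A B. A \<in> K \<Longrightarrow> B \<in> K \<Longrightarrow> A ** B \<in> K"
    and torus: "\<And>v. cmod v = 1 \<Longrightarrow> su2 v 0 \<in> K"
    and "su2 a b \<in> K" and ab: "(cmod a)\<^sup>2 + (cmod b)\<^sup>2 = 1" and "a \<noteq> 0" "b \<noteq> 0"
  shows "SU2 \<subseteq> K"
proof
  define rot :: "real \<Rightarrow> complex ^ 2 ^ 2"
    where "rot \<psi> = su2 (complex_of_real (cos \<psi>)) (complex_of_real (sin \<psi>))" for \<psi>
  have rot_add: "rot \<phi> ** rot \<psi> = rot (\<phi> + \<psi>)" for \<phi> \<psi>
    by (simp add: rot_def su2_mult su2_eq_iff cos_add sin_add)
  have rot_in_K: "rot \<psi> \<in> K" for \<psi>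
  proof -
    have "2 * cmod a * cmod b > 0"
      using \<open>a \<noteq> 0\<close> \<open>b \<noteq> 0\<close> by simp
    then obtain n :: nat where n: "\<bar>\<psi>\<bar> < real n * (2 * cmod a * cmod b)"
      using reals_Archimedean3 by blast
    then have "n > 0"
      by (metis abs_not_less_zero gr0I mult_zero_left of_nat_0)
    have "\<bar>sin (\<psi> / n)\<bar> \<le> \<bar>\<psi> / n\<bar>"
      by (rule abs_sin_x_le_abs_x)
    also have "\<dots> \<le> 2 * cmod a * cmod b"
      using n \<open>n > 0\<close> by (simp add: field_simps)
    finally have step: "rot (\<psi> / n) \<in> K"
      unfolding rot_def
      by (intro su2_small_second_entry[OF mult torus \<open>su2 a b \<in> K\<close> ab]) simp_all
    have "rot (real m * (\<psi> / n)) \<in> K" for m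
    proof (induction m)
      case 0
      show ?case using torus[of 1] by (simp add: rot_def)
    next
      case (Suc m)
      then show ?case
        using mult[OF step Suc.IH] by (simp only: rot_add of_nat_Suc distrib_right mult_1)
    qed
    from this[of n] show ?thesis
      using \<open>n > 0\<close> by simp
  qed
  fix A assume "A \<in> SU2"
  then obtain c d where A: "A = su2 c d" and "c * cnj c + d * cnj d = 1"
    by (rule SU2_cases)
  then have "(cmod c)\<^sup>2 + (cmod d)\<^sup>2 = 1"
    by (simp only: unit_sphere_iff)
  then obtain \<psi> where "cmod c = cos \<psi>" "cmod d = sin \<psi>"
    using sincos_total_2pi by metis
  moreover from this have "cmod c = \<bar>cos \<psi>\<bar>" "cmod d = \<bar>sin \<psi>\<bar>"
    using norm_ge_zero[of c] norm_ge_zero[of d] by linarith+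
  ultimately show "A \<in> K"
    unfolding A
    by (intro su2_change_phases[OF mult torus rot_in_K[of \<psi>, unfolded rot_def]]) simp_all
qed

section \<open>Closed submonoids and dense subgroups\<close>

text \<open>In a basis that makes \<open>A\<close> diagonal, neither entry of the first column of \<open>B\<close> vanishes: if the
  lower one did, \<open>B\<close> would be diagonal and commute with \<open>A\<close>, and if the upper one did, \<open>B\<close> would
  square to \<open>-1\<close>. The change of basis is transferred from \<open>A\<close> and \<open>B\<close> to \<open>K\<close>: the set \<open>L\<close> of the
  proof is \<open>K\<close> as seen in the new basis, and it contains the torus and a generic element.\<close>

lemma SU2_subset_closed_submonoid:
  assumes "closed K" and mult: "\<And>X Y. X \<in> K \<Longrightarrow> Y \<in> K \<Longrightarrow> X ** Y \<in> K" and "mat 1 \<in> K"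
    and A: "A \<in> SU2 \<inter> K" and B: "B \<in> SU2 \<inter> K"
    and A_infinite: "\<And>n::nat. n > 0 \<Longrightarrow> A [^]\<^bsub>U2\<^esub> n \<noteq> mat 1"
    and noncomm: "A ** B \<noteq> B ** A" and B_square: "B ** B \<noteq> - mat 1"
  shows "SU2 \<subseteq> K"
proof -
  obtain P u where P: "P \<in> SU2" and u: "cmod u = 1" and AP: "A ** P = P ** su2 u 0"
    using A by (auto elim: SU2_diagonalise)
  define Q where "Q = conj_transpose P"
  have PQ: "P ** Q = mat 1" "Q ** P = mat 1" and Q: "Q \<in> SU2"
    using P by (simp_all add: Q_def SU2_conj_transpose conj_transpose_in_SU2)
  have PQX: "P ** (Q ** X) = X" and QPX: "Q ** (P ** X) = X" for X
    by (simp_all add: matrix_mul_assoc PQ)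
  define conj where "conj X = P ** X ** Q" for X
  define L where "L = {X. conj X \<in> K}"
  have conj_mult: "conj (X ** Y) = conj X ** conj Y" for X Y
    by (simp add: conj_def QPX flip: matrix_mul_assoc)
  have conj_1: "conj (mat 1) = mat 1"
    by (simp add: conj_def PQ)
  have conj_Q: "conj (Q ** X ** P) = X" for X
    by (simp add: conj_def PQX PQ flip: matrix_mul_assoc)
  have A_eq: "A = conj (su2 u 0)"
    by (metis conj_def AP matrix_mul_assoc PQ(1) matrix_mul_rid)
  define B' where "B' = Q ** B ** P"
  have B_eq: "B = conj B'"
    by (simp add: B'_def conj_Q)
  have "B' \<in> SU2"
    using P Q B by (auto simp: B'_def intro!: SU2_mult_closed)
  then obtain a b where B': "B' = su2 a b" and ab: "a * cnj a + b * cnj b = 1"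
    by (rule SU2_cases)
  have "b \<noteq> 0"
  proof
    assume "b = 0"
    then have "su2 u 0 ** B' = B' ** su2 u 0"
      by (simp add: B' su2_mult mult.commute)
    with noncomm show False
      by (metis A_eq B_eq conj_mult)
  qed
  have "a \<noteq> 0"
  proof
    assume "a = 0"
    then have "B' ** B' = su2 (- 1) 0"
      using ab by (simp add: B' su2_mult su2_eq_iff mult.commute)
    also have "\<dots> = - mat 1"
      by (simp add: su2_def vec_eq_iff forall_2 mat_def)
    finally have "conj B' ** conj B' = conj (- mat 1)"
      by (metis conj_mult)
    also have "\<dots> = - conj (mat 1)"
      by (simp add: conj_def vec_eq_iff forall_2 matrix_matrix_mult_def sum_2 mat_def)
    finally show False
      using B_square by (simp add: B_eq conj_1)
  qed
  have A_power: "A [^]\<^bsub>U2\<^esub> n = conj (su2 (u ^ n) 0)" for n :: nat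
  proof (induction n)
    case 0
    show ?case by (simp add: U2_def conj_1 flip: mat_1_eq_su2)
  next
    case (Suc n)
    then show ?case
      by (simp add: nat_pow_def) (simp add: U2_def A_eq su2_mult mult.commute flip: conj_mult)
  qed
  have u_infinite: "u ^ n \<noteq> 1" if "n > 0" for n :: nat
    using A_infinite[OF that] by (auto simp: A_power conj_1 simp flip: mat_1_eq_su2)
  have "closed L"
  proof -
    have "continuous_on UNIV conj"
      unfolding conj_def matrix_matrix_mult_def by (intro continuous_intros)
    then have "closed (conj -` K)"
      using \<open>closed K\<close> by (simp add: closed_vimage)
    then show ?thesis
      by (simp add: L_def vimage_def)
  qed
  have L_mult: "X ** Y \<in> L" if "X \<in> L" "Y \<in> L" for X Y
    using that mult by (simp add: L_def conj_mult)
  have "su2 v 0 \<in> L" if "cmod v = 1" for v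
    by (rule torus_in_closed_submonoid[OF \<open>closed L\<close> L_mult _ _ u u_infinite that])
      (use A \<open>mat 1 \<in> K\<close> in \<open>auto simp: L_def conj_1 A_eq\<close>)
  moreover have "(cmod a)\<^sup>2 + (cmod b)\<^sup>2 = 1"
    using ab by (simp only: unit_sphere_iff)
  moreover have "su2 a b \<in> L"
    using B by (simp add: L_def flip: B' B_eq)
  ultimately have "SU2 \<subseteq> L"
    using \<open>a \<noteq> 0\<close> \<open>b \<noteq> 0\<close> L_mult by (intro SU2_subset_if_torus_and_generic_element[of L a b])
  show ?thesis
  proof
    fix X assume "X \<in> SU2"
    then have "Q ** X ** P \<in> L"
      using \<open>SU2 \<subseteq> L\<close> P Q by (auto intro!: SU2_mult_closed)
    then show "X \<in> K"
      by (simp add: L_def conj_Q)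
  qed
qed

lemma closure_mult_closed:
  fixes S :: "(complex ^ 2 ^ 2) set"
  assumes S: "\<And>X Y. X \<in> S \<Longrightarrow> Y \<in> S \<Longrightarrow> X ** Y \<in> S"
    and "A \<in> closure S" "B \<in> closure S"
  shows "A ** B \<in> closure S"
proof -
  have "continuous_on UNIV (\<lambda>p. fst p ** snd p :: complex ^ 2 ^ 2)"
    unfolding matrix_matrix_mult_def by (intro continuous_intros)
  then have "(\<lambda>p. fst p ** snd p) ` closure (S \<times> S) \<subseteq> closure S"
    by (intro image_closure_subset)
      (auto intro: continuous_on_subset intro!: S closure_subset[THEN subsetD])
  then show ?thesis
    using assms by (force simp: closure_Times)
qed

lemma (in group) ord_eq_4:
  assumes "x \<in> carrier G" "x [^] (2::nat) \<noteq> \<one>" "x [^] (4::nat) = \<one>"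
  shows "ord x = 4"
proof -
  have "ord x dvd 2 ^ 2" "\<not> ord x dvd 2"
    using assms pow_eq_id[of x 2] pow_eq_id[of x 4] by simp_all
  then obtain i where "i \<le> 2" "ord x = 2 ^ i"
    using divides_primepow_nat[of 2 "ord x" 2] two_is_prime_nat by blast
  then show ?thesis
    using \<open>\<not> ord x dvd 2\<close> by (cases i; cases "i - 1") (auto simp: numeral_2_eq_2)
qed

theorem theorem8p4:
  fixes E :: "'e vbundle"
    and h :: "'e \<Rightarrow> 'e \<Rightarrow> complex"
    and D :: "vfield \<Rightarrow> (torus \<Rightarrow> 'e) \<Rightarrow> (torus \<Rightarrow> 'e)"
    and G :: "(complex ^ 2 ^ 2) set"
    and B1 B2 :: "complex ^ 2 ^ 2"
  assumes "complex_vector_bundle_rank2 E"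
    and "hermitian_metric E h"
    and "h_connection E h D"
    and "topological_holonomy_group E h D G"
    and "G \<subseteq> SU2"
    and "B1 \<in> G" and "B2 \<in> G"
    and "B1 ** B2 \<noteq> B2 ** B1"
    and "elt_order U2 B1 = \<infinity>"
    and "elt_order U2 B2 \<noteq> 2" and "elt_order U2 B2 \<noteq> 4"
  shows "(top_of_set SU2) closure_of G = SU2"
proof -
  interpret U2: group U2 by (rule group_U2)
  obtain C1 C2 where "C1 \<in> carrier U2" "C2 \<in> carrier U2" "G = generate U2 {C1, C2}"
    using \<open>topological_holonomy_group E h D G\<close> unfolding topological_holonomy_group_def by blast
  then interpret G: subgroup G U2
    using U2.generate_is_subgroup by simp
  have mult: "X ** Y \<in> G" if "X \<in> G" "Y \<in> G" for X Y
    using G.m_closed[OF that] by (simp add: U2_def)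
  have one: "\<one>\<^bsub>U2\<^esub> = mat 1"
    by (simp add: U2_def)
  have "U2.ord B1 = 0"
    using \<open>elt_order U2 B1 = \<infinity>\<close> by (auto simp: elt_order_def split: if_splits)
  then have B1_infinite: "B1 [^]\<^bsub>U2\<^esub> n \<noteq> mat 1" if "n > 0" for n :: nat
    using that U2.ord_eq_0 G.mem_carrier \<open>B1 \<in> G\<close> one by auto
  have "B2 ** B2 \<noteq> - mat 1"
  proof
    assume sq: "B2 ** B2 = - mat 1"
    have B2: "B2 \<in> carrier U2"
      using \<open>B2 \<in> G\<close> by (rule G.mem_carrier)
    have two: "B2 [^]\<^bsub>U2\<^esub> (2::nat) = - mat 1"
      using B2 sq by (simp add: numeral_2_eq_2) (simp add: U2_def)
    have "(B2 [^]\<^bsub>U2\<^esub> (2::nat)) [^]\<^bsub>U2\<^esub> (2::nat) = B2 [^]\<^bsub>U2\<^esub> (4::nat)"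
      using B2 by (simp add: U2.nat_pow_pow)
    moreover have "(B2 [^]\<^bsub>U2\<^esub> (2::nat)) [^]\<^bsub>U2\<^esub> (2::nat) = (- mat 1) ** (- mat 1)"
      using B2 two U2.nat_pow_closed[OF B2, of 2]
      by (simp add: numeral_2_eq_2) (simp add: U2_def)
    moreover have "(- mat 1) ** (- mat 1) = (mat 1 :: complex ^ 2 ^ 2)"
      by (simp add: vec_eq_iff forall_2 matrix_matrix_mult_def sum_2 mat_def)
    moreover have "- mat 1 \<noteq> (mat 1 :: complex ^ 2 ^ 2)"
      by (simp add: vec_eq_iff forall_2 mat_def)
    ultimately have "U2.ord B2 = 4"
      using two by (intro U2.ord_eq_4 B2) (simp_all add: one)
    with \<open>elt_order U2 B2 \<noteq> 4\<close> show False
      by (simp add: elt_order_def numeral_eq_enat)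
  qed
  then have "SU2 \<subseteq> closure G"
    using assms(5-8) closure_subset[of G] B1_infinite G.one_closed
    by (intro SU2_subset_closed_submonoid[of _ B1 B2] closure_mult_closed mult) (auto simp: one)
  moreover have "SU2 \<inter> G = G"
    using \<open>G \<subseteq> SU2\<close> by blast
  ultimately show ?thesis
    by (simp add: closure_of_subtopology) blast
qed

end
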